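(* Let $\Gamma$ be a partial order with maximum chain length $n$, let $\Sigma$ be a finite alphabet and let $w,v\in\Sigma^+$. Then the identity $w=v$ is satisfied in $\Gamma(\mathbb{T})$ if and only if for every $u\in\Sigma^*$ with $|u|\le n-1$ and every $(|u|+1)$-vertex path $\rho$ in $\Gamma$ the tropical polynomials $f_{u,\rho}^w$ and $f_{u,\rho}^v$ are equivalent.
   Context: The tropical semiring $\mathbb{T}$ is the set $\mathbb{R}\cup\{-\infty\}$ with operations $a\oplus b=\max(a,b)$ and $a\otimes b=a+b$, where $-\infty\oplus a=a$ and $-\infty\otimes a=-\infty$. $\bigoplus$ over a bounded-above set denotes its supremum, and over the empty set is $-\infty$. $\Gamma$ is a (not necessarily finite) partially ordered set; that it has maximum chain length $n$ means that there exists a sequence $v_1\le\cdots\le v_k$ of $k$ distinct elements of $\Gamma$ if and only if $k\le n$. $\Gamma(\mathbb{T})$ is the semigroup of all functions $A:\Gamma\times\Gamma\to\mathbb{T}$, written $(i,j)\mapsto A_{i,j}$, that are bounded above (the set of all entries has an upper bound in $\mathbb{T}$) and satisfy $A_{i,j}\ne-\infty\Rightarrow i\le j$, with multiplication $(M\otimes N)_{i,j}=\bigoplus_{k\in\Gamma}M_{i,k}\otimes N_{k,j}$. $\Sigma^*$ and $\Sigma^+$ are the free monoid and free semigroup on $\Sigma$; $|w|$ is the length of $w$ and $w_i$ its $i$th letter. The identity $w=v$ is satisfied in a semigroup $S$ if every semigroup morphism $\Sigma^+\to S$ maps $w$ and $v$ to the same element. A $k$-vertex path in $\Gamma$ is a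 $k$-tuple $(v_1,\dots,v_k)$ of pairwise distinct elements with $v_1\le v_2\le\cdots\le v_k$. For $0\le p<q\le|w|+1$ and $s\in\Sigma$ let $\beta_s^w(p,q)=|\{i\in\mathbb{N}: p<i<q,\ w_i=s\}|$. For $u\in\Sigma^*$ with $|u|\le n-1$ and a $(|u|+1)$-vertex path $\rho=(\rho_0,\dots,\rho_{|u|})$ in $\Gamma$, define the formal tropical polynomial in variables $x(s,i)$ ($s\in\Sigma$, $i\in\Gamma$) $$f_{u,\rho}^w=\bigoplus\ \bigotimes_{s\in\Sigma}\bigotimes_{k=0}^{|u|}x(s,\rho_k)^{\beta_s^w(\alpha_k,\alpha_{k+1})},$$ where the sum ranges over all $0=\alpha_0<\alpha_1<\cdots<\alpha_{|u|}<\alpha_{|u|+1}=|w|+1$ such that $w_{\alpha_k}=u_k$ for $k=1,\dots,|u|$. Powers are interpreted tropically ($x^m$ means $m\cdot x$ classically, $x^0$ is the constant $0$). Two formal tropical polynomials are equivalent if they define the same function $\mathbb{T}^{\Sigma\times\Gamma}\to\mathbb{T}$ by evaluation. *)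

theory Defs
  imports Complex_Main "HOL-Library.FuncSet" "HOL-Library.Poly_Mapping"
begin

section \<open>The tropical semiring\<close>

datatype trop = MInf | Fin real

instantiation trop :: linorder
begin

fun less_eq_trop :: "trop \<Rightarrow> trop \<Rightarrow> bool" where
  "MInf \<le> b \<longleftrightarrow> True"
| "Fin x \<le> MInf \<longleftrightarrow> False"
| "Fin x \<le> Fin y \<longleftrightarrow> x \<le> y"

definition less_trop :: "trop \<Rightarrow> trop \<Rightarrow> bool" where
  "(a::trop) < b \<longleftrightarrow> a \<le> b \<and> \<not> b \<le> a"

instance
proof
  fix a b c :: trop
  show "a < b \<longleftrightarrow> a \<le> b \<and> \<not> b \<le> a" by (fact less_trop_def)
  show "a \<le> a" by (cases a) auto
  show "a \<le> b \<Longrightarrow> b \<le> c \<Longrightarrow> a \<le> c" by (cases a; cases b; cases c) auto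
  show "a \<le> b \<Longrightarrow> b \<le> a \<Longrightarrow> a = b" by (cases a; cases b) auto
  show "a \<le> b \<or> b \<le> a" by (cases a; cases b) auto
qed

end

instantiation trop :: conditionally_complete_linorder
begin

definition sup_trop :: "trop \<Rightarrow> trop \<Rightarrow> trop" where
  "sup_trop = max"

definition inf_trop :: "trop \<Rightarrow> trop \<Rightarrow> trop" where
  "inf_trop = min"

definition Sup_trop :: "trop set \<Rightarrow> trop" where
  "Sup (A :: trop set) = (if A \<subseteq> {MInf} then MInf else Fin (Sup {x. Fin x \<in> A}))"

definition Inf_trop :: "trop set \<Rightarrow> trop" where
  "Inf (A :: trop set) = (if MInf \<in> A \<or> \<not> bdd_below {x. Fin x \<in> A} then MInf
    else Fin (Inf {x. Fin x \<in> A}))"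

instance
proof
  fix x y z :: trop and X :: "trop set"
  show "inf x y \<le> x" "inf x y \<le> y" "x \<le> y \<Longrightarrow> x \<le> z \<Longrightarrow> x \<le> inf y z"
    by (auto simp: inf_trop_def)
  show "x \<le> sup x y" "y \<le> sup x y" "y \<le> x \<Longrightarrow> z \<le> x \<Longrightarrow> sup y z \<le> x"
    by (auto simp: sup_trop_def)
  show "Inf X \<le> x" if "x \<in> X" "bdd_below X"
  proof (cases x)
    case (Fin a)
    with that show ?thesis by (auto simp: Inf_trop_def intro: cInf_lower)
  next
    case MInf
    with that show ?thesis by (auto simp: Inf_trop_def)
  qed
  show "z \<le> Inf X" if ne: "X \<noteq> {}" and lb: "\<And>x. x \<in> X \<Longrightarrow> z \<le> x"
  proof (cases z)
    case (Fin c)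
    have nm: "MInf \<notin> X" using lb[of MInf] Fin by auto
    have le: "c \<le> y" if "Fin y \<in> X" for y using lb[OF that] Fin by simp
    obtain y where "y \<in> X" using ne by auto
    with nm obtain r where "Fin r \<in> X" by (cases y) auto
    then have "c \<le> Inf {x. Fin x \<in> X}" using le by (intro cInf_greatest) auto
    moreover have "bdd_below {x. Fin x \<in> X}" using le by (intro bdd_belowI[of _ c]) auto
    ultimately show ?thesis using nm Fin by (simp add: Inf_trop_def)
  qed simp
  show "x \<le> Sup X" if x: "x \<in> X" and bd: "bdd_above X"
  proof (cases x)
    case (Fin a)
    obtain M where M: "\<And>y. y \<in> X \<Longrightarrow> y \<le> M"
      using bd by (auto simp: bdd_above.unfold)
    obtain m where m: "M = Fin m" using M[OF x] Fin by (cases M) auto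
    have "bdd_above {x. Fin x \<in> X}" using M m by (intro bdd_aboveI[of _ m]) fastforce
    then have "a \<le> Sup {x. Fin x \<in> X}" using x Fin by (intro cSup_upper) auto
    then show ?thesis using x Fin by (auto simp: Sup_trop_def)
  qed simp
  show "Sup X \<le> z" if ne: "X \<noteq> {}" and ub: "\<And>x. x \<in> X \<Longrightarrow> x \<le> z"
  proof (cases "X \<subseteq> {MInf}")
    case False
    then obtain y where y: "y \<in> X" "y \<noteq> MInf" by auto
    then obtain r where r: "Fin r \<in> X" by (cases y) auto
    then obtain c where c: "z = Fin c" using ub[OF r] by (cases z) auto
    have "Sup {x. Fin x \<in> X} \<le> c" using r ub c by (intro cSup_least) fastforce+
    then show ?thesis using False c by (auto simp: Sup_trop_def)
  qed (simp add: Sup_trop_def)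
qed

end

text \<open>
  The semiring operations are tropical: \<open>+\<close> is the maximum, \<open>*\<close> is real addition, \<open>0\<close> is
  minus infinity and \<open>1\<close> is the real number zero. Hence \<open>\<Sum>\<close> and \<open>\<Prod>\<close> over finite sets and
  \<open>x ^ m\<close> are the tropical sum, product and power.
\<close>

instantiation trop :: comm_semiring_1
begin

definition zero_trop :: trop where "0 = MInf"

definition one_trop :: trop where "1 = Fin 0"

definition plus_trop :: "trop \<Rightarrow> trop \<Rightarrow> trop" where
  "(a::trop) + b = max a b"

fun times_trop :: "trop \<Rightarrow> trop \<Rightarrow> trop" where
  "MInf * b = MInf"
| "Fin x * MInf = MInf"
| "Fin x * Fin y = Fin (x + y)"

instance
proof
  fix a b c :: trop
  show "a * b * c = a * (b * c)" by (cases a; cases b; cases c) auto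
  show "a * b = b * a" by (cases a; cases b) auto
  show "1 * a = a" by (cases a) (auto simp: one_trop_def)
  show "a + b + c = a + (b + c)" by (simp add: plus_trop_def max.assoc)
  show "a + b = b + a" by (simp add: plus_trop_def max.commute)
  show "0 + a = a" by (simp add: plus_trop_def zero_trop_def max_def)
  show "0 * a = 0" by (simp add: zero_trop_def)
  show "a * 0 = 0" by (cases a) (auto simp: zero_trop_def)
  show "(a + b) * c = a * c + b * c"
    by (cases a; cases b; cases c) (auto simp: plus_trop_def max_def)
  show "(0::trop) \<noteq> 1" by (simp add: zero_trop_def one_trop_def)
qed

end

lemma Sup_trop_empty: "Sup ({} :: trop set) = MInf"
  by (simp add: Sup_trop_def)

lemma Fin_power: "Fin x ^ m = Fin (real m * x)"
  by (induction m) (auto simp: one_trop_def algebra_simps)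

lemma MInf_power: "MInf ^ m = (if m = 0 then Fin 0 else MInf)"
  by (cases m) (auto simp: one_trop_def)

section \<open>Semigroup identities\<close>

definition semigroup_morphism ::
  "'a set \<Rightarrow> ('a \<Rightarrow> 'a \<Rightarrow> 'a) \<Rightarrow> 'b set \<Rightarrow> ('b \<Rightarrow> 'b \<Rightarrow> 'b) \<Rightarrow> ('a \<Rightarrow> 'b) \<Rightarrow> bool" where
  "semigroup_morphism S f T g \<phi> \<longleftrightarrow>
    \<phi> \<in> S \<rightarrow> T \<and> (\<forall>x\<in>S. \<forall>y\<in>S. \<phi> (f x y) = g (\<phi> x) (\<phi> y))"

definition free_semigroup :: "'s list set" where
  "free_semigroup = {w. w \<noteq> []}"

definition satisfies_identity ::
  "'b set \<Rightarrow> ('b \<Rightarrow> 'b \<Rightarrow> 'b) \<Rightarrow> 's list \<Rightarrow> 's list \<Rightarrow> bool" where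
  "satisfies_identity S g w v \<longleftrightarrow>
    (\<forall>\<phi>. semigroup_morphism free_semigroup (@) S g \<phi> \<longrightarrow> \<phi> w = \<phi> v)"

section \<open>Paths and matrices over a partially ordered set\<close>

definition is_path :: "'g::order set \<Rightarrow> nat \<Rightarrow> 'g list \<Rightarrow> bool" where
  "is_path \<Gamma> k \<rho> \<longleftrightarrow> length \<rho> = k \<and> set \<rho> \<subseteq> \<Gamma> \<and> distinct \<rho> \<and> sorted_wrt (\<le>) \<rho>"

definition max_chain_length :: "'g::order set \<Rightarrow> nat \<Rightarrow> bool" where
  "max_chain_length \<Gamma> n \<longleftrightarrow> (\<forall>k. (\<exists>\<rho>. is_path \<Gamma> k \<rho>) \<longleftrightarrow> k \<le> n)"

text \<open>
  A matrix indexed by \<open>\<Gamma>\<close> is represented by its extension by minus infinity to the whole index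
  type, so that distinct elements of the carrier are distinct as functions on \<open>\<Gamma> \<times> \<Gamma>\<close>.
\<close>

type_synonym 'g trop_matrix = "'g \<Rightarrow> 'g \<Rightarrow> trop"

definition chain_matrices :: "'g::order set \<Rightarrow> 'g trop_matrix set" where
  "chain_matrices \<Gamma> = {A. bdd_above {A i j | i j. i \<in> \<Gamma> \<and> j \<in> \<Gamma>} \<and>
    (\<forall>i\<in>\<Gamma>. \<forall>j\<in>\<Gamma>. A i j \<noteq> MInf \<longrightarrow> i \<le> j) \<and>
    (\<forall>i j. i \<notin> \<Gamma> \<or> j \<notin> \<Gamma> \<longrightarrow> A i j = MInf)}"

definition matrix_mult :: "'g set \<Rightarrow> 'g trop_matrix \<Rightarrow> 'g trop_matrix \<Rightarrow> 'g trop_matrix" where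
  "matrix_mult \<Gamma> M N = (\<lambda>i j. SUP k\<in>\<Gamma>. M i k * N k j)"

section \<open>Formal tropical polynomials\<close>

text \<open>
  Finitely supported maps from monomials to coefficients; a monomial is a finitely supported map
  from variables to exponents. Sum and product are the polynomial ones over the semiring \<^typ>\<open>trop\<close>.
\<close>

type_synonym 'x trop_poly = "('x \<Rightarrow>\<^sub>0 nat) \<Rightarrow>\<^sub>0 trop"

definition trop_var :: "'x \<Rightarrow> 'x trop_poly" where
  "trop_var x = Poly_Mapping.single (Poly_Mapping.single x 1) 1"

definition trop_eval :: "('x \<Rightarrow> trop) \<Rightarrow> 'x trop_poly \<Rightarrow> trop" where
  "trop_eval a p = (\<Sum>m\<in>Poly_Mapping.keys p. Poly_Mapping.lookup p m *
    (\<Prod>x\<in>Poly_Mapping.keys m. a x ^ Poly_Mapping.lookup m x))"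

definition trop_equivalent :: "'x trop_poly \<Rightarrow> 'x trop_poly \<Rightarrow> bool" where
  "trop_equivalent p q \<longleftrightarrow> (\<forall>a. trop_eval a p = trop_eval a q)"

section \<open>The polynomials of a word\<close>

text \<open>Positions in words are counted from 1.\<close>

definition letter :: "'s list \<Rightarrow> nat \<Rightarrow> 's" where
  "letter w i = w ! (i - 1)"

definition \<beta> :: "'s list \<Rightarrow> 's \<Rightarrow> nat \<Rightarrow> nat \<Rightarrow> nat" where
  "\<beta> w s p q = card {i. p < i \<and> i < q \<and> letter w i = s}"

text \<open>The tuples \<open>\<alpha> = (\<alpha>\<^sub>0, \<dots>, \<alpha>\<^bsub>|u|+1\<^esub>)\<close> marking an occurrence of \<open>u\<close> as a scattered subword of \<open>w\<close>.\<close>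

definition occurrences :: "'s list \<Rightarrow> 's list \<Rightarrow> nat list set" where
  "occurrences u w = {\<alpha>. length \<alpha> = length u + 2 \<and> sorted_wrt (<) \<alpha> \<and>
    \<alpha> ! 0 = 0 \<and> \<alpha> ! (length u + 1) = length w + 1 \<and>
    (\<forall>k\<in>{1..length u}. letter w (\<alpha> ! k) = letter u k)}"

lemma finite_occurrences: "finite (occurrences u w)"
proof (rule finite_subset)
  show "occurrences u w \<subseteq> {\<alpha>. set \<alpha> \<subseteq> {..length w + 1} \<and> length \<alpha> = length u + 2}"
  proof
    fix \<alpha> assume a: "\<alpha> \<in> occurrences u w"
    have "\<alpha> ! i \<le> length w + 1" if "i < length \<alpha>" for i
    proof (cases "i = length u + 1")
      case False
      then have "\<alpha> ! i < \<alpha> ! (length u + 1)"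
        using a that sorted_wrt_nth_less[of "(<)" \<alpha> i "length u + 1"]
        by (auto simp: occurrences_def)
      then show ?thesis using a by (simp add: occurrences_def)
    qed (use a in \<open>simp add: occurrences_def\<close>)
    then show "\<alpha> \<in> {\<alpha>. set \<alpha> \<subseteq> {..length w + 1} \<and> length \<alpha> = length u + 2}"
      using a by (auto simp: occurrences_def set_conv_nth simp del: One_nat_def)
  qed
qed (simp add: finite_lists_length_eq)

text \<open>
  The variables that occur all lie in \<open>UNIV \<times> \<Gamma>\<close> when \<open>\<rho>\<close> is a path in \<open>\<Gamma>\<close>, so for these
  polynomials \<^const>\<open>trop_equivalent\<close> is equality of functions on the assignments to \<open>UNIV \<times> \<Gamma>\<close>.
\<close>

definition word_poly :: "'s::finite list \<Rightarrow> 'g list \<Rightarrow> 's list \<Rightarrow> ('s \<times> 'g) trop_poly" where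
  "word_poly u \<rho> w = (\<Sum>\<alpha>\<in>occurrences u w. \<Prod>s\<in>UNIV. \<Prod>k=0..length u.
    trop_var (s, \<rho> ! k) ^ \<beta> w s (\<alpha> ! k) (\<alpha> ! (k + 1)))"

end

theory Submission
  imports Defs
begin

text \<open>
  Splitting off the first letter of a word expresses both the entries of its matrix and the values
  of its polynomials by the same recursion: the letter either stays at a vertex, contributing a
  diagonal entry, or moves on to a larger vertex, contributing an off-diagonal entry. Hence entry
  \<open>(i, j)\<close> of the image of a word is the supremum, over all \<open>u\<close> and all paths \<open>\<rho>\<close> from \<open>i\<close> to
  \<open>j\<close>, of the product of the off-diagonal entries along \<open>\<rho>\<close> labelled by \<open>u\<close> with the value of
  the polynomial at the diagonal entries. Conversely, for given \<open>u\<close> and \<open>\<rho>\<close>, matrices whose only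
  off-diagonal entries are zeros at the steps of \<open>\<rho>\<close> leave a single term in this supremum, so
  that every value of the polynomial is a matrix entry.
\<close>

section \<open>Suprema and products in the tropical semiring\<close>

lemma trop_times_MInf [simp]: "a * MInf = MInf"
  by (cases a) auto

lemma trop_times_eq_MInf [simp]: "a * b = MInf \<longleftrightarrow> a = MInf \<or> b = MInf"
  by (cases a; cases b) auto

lemma trop_le_MInf [simp]: "a \<le> MInf \<longleftrightarrow> a = MInf"
  by (cases a) auto

lemma trop_add_le_iff: "a + b \<le> c \<longleftrightarrow> a \<le> c \<and> b \<le> c" for a b c :: trop
  by (simp add: plus_trop_def)

lemma trop_mult_mono: "a * c \<le> b * d" if "a \<le> b" "c \<le> d" for a b c d :: trop
  using that by (cases a; cases b; cases c; cases d) auto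

text \<open>A finite x has the inverse \<open>Fin (- c)\<close>, so it can be moved to the other
  side, where it gives a bound for the family \<open>f\<close>; if x is minus infinity or K is
  empty, the left side is minus infinity.\<close>

lemma trop_mult_SUP_le:
  fixes x z :: trop
  assumes "\<And>k. k \<in> K \<Longrightarrow> x * f k \<le> z"
  shows "x * (SUP k\<in>K. f k) \<le> z"
proof (cases "x = MInf \<or> K = {}")
  case True
  then show ?thesis by (auto simp: Sup_trop_empty)
next
  case False
  then obtain c where c: "x = Fin c" by (cases x) auto
  have "f k \<le> Fin (- c) * z" if "k \<in> K" for k
    using assms[OF that] c by (cases z; cases "f k") auto
  then have "(SUP k\<in>K. f k) \<le> Fin (- c) * z"
    using False by (intro cSUP_least) auto
  then show ?thesis using c by (cases z; cases "SUP k\<in>K. f k") auto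
qed

section \<open>The semigroup of matrices\<close>

lemma chain_matrices_bounded:
  assumes "M \<in> chain_matrices \<Gamma>"
  obtains B where "\<And>i j. M i j \<le> B"
proof -
  obtain B where "\<And>x. x \<in> {M i j | i j. i \<in> \<Gamma> \<and> j \<in> \<Gamma>} \<Longrightarrow> x \<le> B"
    using assms by (auto simp: chain_matrices_def bdd_above.unfold)
  moreover have "M i j = MInf" if "i \<notin> \<Gamma> \<or> j \<notin> \<Gamma>" for i j
    using assms that by (auto simp: chain_matrices_def)
  ultimately have "M i j \<le> B" for i j
    by (cases "i \<in> \<Gamma> \<and> j \<in> \<Gamma>") auto
  then show thesis by (rule that)
qed

lemma chain_matricesI:
  assumes "\<And>i j. M i j \<le> B"
    and "\<And>i j. M i j \<noteq> MInf \<Longrightarrow> i \<in> \<Gamma> \<and> j \<in> \<Gamma> \<and> i \<le> j"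
  shows "M \<in> chain_matrices \<Gamma>"
  using assms by (auto simp: chain_matrices_def intro!: bdd_aboveI[of _ B])

lemma chain_matrices_support:
  "M \<in> chain_matrices \<Gamma> \<Longrightarrow> M i j \<noteq> MInf \<Longrightarrow> i \<in> \<Gamma> \<and> j \<in> \<Gamma> \<and> i \<le> j"
  by (auto simp: chain_matrices_def)

text \<open>This is where boundedness matters: the supremum is an upper bound only of a bounded
  family, and the product of the bounds of \<open>M\<close> and \<open>N\<close> bounds every
  term.\<close>

lemma mult_le_matrix_mult:
  assumes "M \<in> chain_matrices \<Gamma>" "N \<in> chain_matrices \<Gamma>" "k \<in> \<Gamma>"
  shows "M i k * N k j \<le> matrix_mult \<Gamma> M N i j"
proof -
  obtain B where B: "\<And>i j. M i j \<le> B" using chain_matrices_bounded[OF assms(1)] by metis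
  obtain C where C: "\<And>i j. N i j \<le> C" using chain_matrices_bounded[OF assms(2)] by metis
  have "bdd_above ((\<lambda>k. M i k * N k j) ` \<Gamma>)"
    by (intro bdd_aboveI[of _ "B * C"]) (auto intro!: trop_mult_mono B C)
  then show ?thesis
    unfolding matrix_mult_def using assms(3) by (intro cSUP_upper) auto
qed

text \<open>
  Infinite suprema need not be attained, and \<open>x\<close> may be minus infinity, so inequalities are stated
  with a factor \<open>x\<close> that absorbs the rest of the product.
\<close>

lemma mult_matrix_mult_le:
  assumes "\<And>k. k \<in> \<Gamma> \<Longrightarrow> x * (M i k * N k j) \<le> z"
  shows "x * matrix_mult \<Gamma> M N i j \<le> z"
  unfolding matrix_mult_def using assms by (rule trop_mult_SUP_le)

lemma matrix_mult_le:
  assumes "\<And>k. k \<in> \<Gamma> \<Longrightarrow> M i k * N k j \<le> z"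
  shows "matrix_mult \<Gamma> M N i j \<le> z"
  using mult_matrix_mult_le[of \<Gamma> 1 M i N j z] assms by simp

lemma matrix_mult_closed:
  assumes "M \<in> chain_matrices \<Gamma>" "N \<in> chain_matrices \<Gamma>"
  shows "matrix_mult \<Gamma> M N \<in> chain_matrices \<Gamma>"
proof -
  obtain B where B: "\<And>i j. M i j \<le> B" using chain_matrices_bounded[OF assms(1)] by metis
  obtain C where C: "\<And>i j. N i j \<le> C" using chain_matrices_bounded[OF assms(2)] by metis
  show ?thesis
  proof (rule chain_matricesI[where B = "B * C"])
    show "matrix_mult \<Gamma> M N i j \<le> B * C" for i j
      by (intro matrix_mult_le trop_mult_mono B C)
    show "i \<in> \<Gamma> \<and> j \<in> \<Gamma> \<and> i \<le> j" if nz: "matrix_mult \<Gamma> M N i j \<noteq> MInf" for i j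
    proof (rule ccontr)
      assume neg: "\<not> ?thesis"
      \<comment> \<open>A term with both factors finite would force i \<le> k \<le> j inside
        \<Gamma>, so every term is minus infinity.\<close>
      have "matrix_mult \<Gamma> M N i j \<le> MInf"
      proof (rule matrix_mult_le, rule ccontr)
        fix k assume "\<not> M i k * N k j \<le> MInf"
        then have "M i k \<noteq> MInf" "N k j \<noteq> MInf" by auto
        then show False
          using neg chain_matrices_support[OF assms(1)] chain_matrices_support[OF assms(2)]
            order.trans by metis
      qed
      with nz show False by simp
    qed
  qed
qed

text \<open>Each inequality reduces to a comparison of triple products: the inner supremum is
  removed under the remaining factor, and then the factors are regrouped.\<close>

lemma matrix_mult_assoc:
  assumes M: "M \<in> chain_matrices \<Gamma>" and N: "N \<in> chain_matrices \<Gamma>" and P: "P \<in> chain_matrices \<Gamma>"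
  shows "matrix_mult \<Gamma> (matrix_mult \<Gamma> M N) P = matrix_mult \<Gamma> M (matrix_mult \<Gamma> N P)"
proof (intro ext antisym)
  fix i j
  show "matrix_mult \<Gamma> (matrix_mult \<Gamma> M N) P i j \<le> matrix_mult \<Gamma> M (matrix_mult \<Gamma> N P) i j"
  proof (rule matrix_mult_le)
    fix k assume k: "k \<in> \<Gamma>"
    have "P k j * matrix_mult \<Gamma> M N i k \<le> matrix_mult \<Gamma> M (matrix_mult \<Gamma> N P) i j"
    proof (rule mult_matrix_mult_le)
      fix l assume l: "l \<in> \<Gamma>"
      have "P k j * (M i l * N l k) = M i l * (N l k * P k j)"
        by (simp add: ac_simps)
      also have "\<dots> \<le> M i l * matrix_mult \<Gamma> N P l j"
        by (intro trop_mult_mono mult_le_matrix_mult N P k order.refl)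
      also have "\<dots> \<le> matrix_mult \<Gamma> M (matrix_mult \<Gamma> N P) i j"
        by (intro mult_le_matrix_mult M matrix_mult_closed N P l)
      finally show "P k j * (M i l * N l k) \<le> matrix_mult \<Gamma> M (matrix_mult \<Gamma> N P) i j" .
    qed
    then show "matrix_mult \<Gamma> M N i k * P k j \<le> matrix_mult \<Gamma> M (matrix_mult \<Gamma> N P) i j"
      by (simp add: mult.commute)
  qed
  show "matrix_mult \<Gamma> M (matrix_mult \<Gamma> N P) i j \<le> matrix_mult \<Gamma> (matrix_mult \<Gamma> M N) P i j"
  proof (rule matrix_mult_le, rule mult_matrix_mult_le)
    fix k l assume k: "k \<in> \<Gamma>" and l: "l \<in> \<Gamma>"
    have "M i k * (N k l * P l j) = M i k * N k l * P l j"
      by (simp add: ac_simps)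
    also have "\<dots> \<le> matrix_mult \<Gamma> M N i l * P l j"
      by (intro trop_mult_mono mult_le_matrix_mult M N k order.refl)
    also have "\<dots> \<le> matrix_mult \<Gamma> (matrix_mult \<Gamma> M N) P i j"
      by (intro mult_le_matrix_mult P matrix_mult_closed M N l)
    finally show "M i k * (N k l * P l j) \<le> matrix_mult \<Gamma> (matrix_mult \<Gamma> M N) P i j" .
  qed
qed

section \<open>The identity matrix and the extension of letter matrices to words\<close>

definition id_matrix :: "'g set \<Rightarrow> 'g trop_matrix" where
  "id_matrix \<Gamma> = (\<lambda>i j. if i = j \<and> i \<in> \<Gamma> then 1 else MInf)"

lemma id_matrix_closed: "id_matrix \<Gamma> \<in> chain_matrices \<Gamma>"
  by (rule chain_matricesI[where B = 1]) (auto simp: id_matrix_def split: if_splits)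

lemma matrix_mult_id_left:
  assumes "M \<in> chain_matrices \<Gamma>"
  shows "matrix_mult \<Gamma> (id_matrix \<Gamma>) M = M"
proof (intro ext antisym)
  fix i j
  show "matrix_mult \<Gamma> (id_matrix \<Gamma>) M i j \<le> M i j"
    by (rule matrix_mult_le) (simp add: id_matrix_def)
  show "M i j \<le> matrix_mult \<Gamma> (id_matrix \<Gamma>) M i j"
  proof (cases "M i j = MInf")
    case False
    then have "i \<in> \<Gamma>" using chain_matrices_support[OF assms] by blast
    then show ?thesis
      using mult_le_matrix_mult[OF id_matrix_closed assms, of i i j] by (simp add: id_matrix_def)
  qed simp
qed

lemma matrix_mult_id_right:
  assumes "M \<in> chain_matrices \<Gamma>"
  shows "matrix_mult \<Gamma> M (id_matrix \<Gamma>) = M"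
proof (intro ext antisym)
  fix i j
  show "matrix_mult \<Gamma> M (id_matrix \<Gamma>) i j \<le> M i j"
    by (rule matrix_mult_le) (simp add: id_matrix_def)
  show "M i j \<le> matrix_mult \<Gamma> M (id_matrix \<Gamma>) i j"
  proof (cases "M i j = MInf")
    case False
    then have "j \<in> \<Gamma>" using chain_matrices_support[OF assms] by blast
    then show ?thesis
      using mult_le_matrix_mult[OF assms id_matrix_closed, of j i j] by (simp add: id_matrix_def)
  qed simp
qed

text \<open>The monoid extension of a map on letters; starting at the empty word rather than at
  single letters keeps later inductions uniform.\<close>

primrec word_matrix :: "'g set \<Rightarrow> ('s \<Rightarrow> 'g trop_matrix) \<Rightarrow> 's list \<Rightarrow> 'g trop_matrix" where
  "word_matrix \<Gamma> A [] = id_matrix \<Gamma>"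
| "word_matrix \<Gamma> A (s # w) = matrix_mult \<Gamma> (A s) (word_matrix \<Gamma> A w)"

lemma word_matrix_closed:
  "(\<And>s. A s \<in> chain_matrices \<Gamma>) \<Longrightarrow> word_matrix \<Gamma> A w \<in> chain_matrices \<Gamma>"
  by (induction w) (auto intro: id_matrix_closed matrix_mult_closed)

lemma word_matrix_append:
  assumes "\<And>s. A s \<in> chain_matrices \<Gamma>"
  shows "word_matrix \<Gamma> A (w @ v) = matrix_mult \<Gamma> (word_matrix \<Gamma> A w) (word_matrix \<Gamma> A v)"
  by (induction w)
    (simp_all add: matrix_mult_id_left matrix_mult_assoc word_matrix_closed assms)

lemma morphism_eq_word_matrix:
  assumes "semigroup_morphism free_semigroup (@) (chain_matrices \<Gamma>) (matrix_mult \<Gamma>) \<phi>"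
    and "w \<noteq> []"
  shows "\<phi> w = word_matrix \<Gamma> (\<lambda>s. \<phi> [s]) w"
  using assms(2)
proof (induction w rule: list_nonempty_induct)
  case (single s)
  have "\<phi> [s] \<in> chain_matrices \<Gamma>"
    using assms(1) by (auto simp: semigroup_morphism_def free_semigroup_def)
  then show ?case by (simp add: matrix_mult_id_right)
next
  case (cons s w)
  have "\<phi> ([s] @ w) = matrix_mult \<Gamma> (\<phi> [s]) (\<phi> w)"
    using assms(1) cons.hyps unfolding semigroup_morphism_def free_semigroup_def by blast
  then show ?case using cons.IH by simp
qed

text \<open>A morphism from a free semigroup is determined by its values on letters, which are
  arbitrary, so the quantifier over morphisms becomes one over families of matrices. Non-emptiness
  matters: the value of a morphism at \<open>[]\<close> is unconstrained.\<close>

lemma satisfies_identity_iff_word_matrix: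
  fixes w v :: "'s list" and \<Gamma> :: "'g::order set"
  assumes "w \<noteq> []" "v \<noteq> []"
  shows "satisfies_identity (chain_matrices \<Gamma>) (matrix_mult \<Gamma>) w v \<longleftrightarrow>
    (\<forall>A. (\<forall>s. A s \<in> chain_matrices \<Gamma>) \<longrightarrow> word_matrix \<Gamma> A w = word_matrix \<Gamma> A v)"
proof (intro iffI allI impI)
  fix A :: "'s \<Rightarrow> 'g trop_matrix"
  assume id: "satisfies_identity (chain_matrices \<Gamma>) (matrix_mult \<Gamma>) w v"
    and "\<forall>s. A s \<in> chain_matrices \<Gamma>"
  then have "semigroup_morphism free_semigroup (@) (chain_matrices \<Gamma>) (matrix_mult \<Gamma>)
      (word_matrix \<Gamma> A)"
    by (auto simp: semigroup_morphism_def word_matrix_append intro: word_matrix_closed)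
  with id show "word_matrix \<Gamma> A w = word_matrix \<Gamma> A v"
    unfolding satisfies_identity_def by blast
next
  assume eq: "\<forall>A. (\<forall>s. A s \<in> chain_matrices \<Gamma>) \<longrightarrow> word_matrix \<Gamma> A w = word_matrix \<Gamma> A v"
  show "satisfies_identity (chain_matrices \<Gamma>) (matrix_mult \<Gamma>) w v"
    unfolding satisfies_identity_def
  proof (intro allI impI)
    fix \<phi> :: "'s list \<Rightarrow> 'g trop_matrix"
    assume \<phi>: "semigroup_morphism free_semigroup (@) (chain_matrices \<Gamma>) (matrix_mult \<Gamma>) \<phi>"
    then have "\<forall>s. \<phi> [s] \<in> chain_matrices \<Gamma>"
      by (auto simp: semigroup_morphism_def free_semigroup_def)
    then have "word_matrix \<Gamma> (\<lambda>s. \<phi> [s]) w = word_matrix \<Gamma> (\<lambda>s. \<phi> [s]) v"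
      using eq[rule_format, of "\<lambda>s. \<phi> [s]"] by simp
    then show "\<phi> w = \<phi> v"
      unfolding morphism_eq_word_matrix[OF \<phi> assms(1)] morphism_eq_word_matrix[OF \<phi> assms(2)] .
  qed
qed

section \<open>Evaluation of the polynomials of a word\<close>

definition mono_eval :: "('x \<Rightarrow> trop) \<Rightarrow> ('x \<Rightarrow>\<^sub>0 nat) \<Rightarrow> trop" where
  "mono_eval a m = (\<Prod>x\<in>Poly_Mapping.keys m. a x ^ Poly_Mapping.lookup m x)"

lemma mono_eval_superset:
  assumes "finite X" "Poly_Mapping.keys m \<subseteq> X"
  shows "mono_eval a m = (\<Prod>x\<in>X. a x ^ Poly_Mapping.lookup m x)"
  unfolding mono_eval_def using assms
  by (intro prod.mono_neutral_left) (auto simp: in_keys_iff)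

lemma mono_eval_zero [simp]: "mono_eval a 0 = 1"
  by (simp add: mono_eval_def)

lemma mono_eval_add: "mono_eval a (m + m') = mono_eval a m * mono_eval a m'"
proof -
  let ?X = "Poly_Mapping.keys m \<union> Poly_Mapping.keys m'"
  have "mono_eval a (m + m') = (\<Prod>x\<in>?X. a x ^ Poly_Mapping.lookup (m + m') x)"
    by (rule mono_eval_superset) (auto simp: keys_add)
  also have "\<dots> = (\<Prod>x\<in>?X. a x ^ Poly_Mapping.lookup m x) * (\<Prod>x\<in>?X. a x ^ Poly_Mapping.lookup m' x)"
    by (simp add: lookup_add power_add prod.distrib)
  also have "\<dots> = mono_eval a m * mono_eval a m'"
    by (simp add: mono_eval_superset[of ?X])
  finally show ?thesis .
qed

lemma trop_eval_superset:
  assumes "finite X" "Poly_Mapping.keys p \<subseteq> X"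
  shows "trop_eval a p = (\<Sum>m\<in>X. Poly_Mapping.lookup p m * mono_eval a m)"
  unfolding trop_eval_def mono_eval_def[symmetric] using assms
  by (intro sum.mono_neutral_left) (auto simp: in_keys_iff)

lemma trop_eval_zero [simp]: "trop_eval a 0 = 0"
  by (simp add: trop_eval_def)

lemma trop_eval_add: "trop_eval a (p + q) = trop_eval a p + trop_eval a q"
proof -
  let ?X = "Poly_Mapping.keys p \<union> Poly_Mapping.keys q"
  have "trop_eval a (p + q) = (\<Sum>m\<in>?X. Poly_Mapping.lookup (p + q) m * mono_eval a m)"
    by (rule trop_eval_superset) (auto simp: keys_add)
  also have "\<dots> = (\<Sum>m\<in>?X. Poly_Mapping.lookup p m * mono_eval a m)
      + (\<Sum>m\<in>?X. Poly_Mapping.lookup q m * mono_eval a m)"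
    by (simp add: lookup_add distrib_right sum.distrib)
  also have "\<dots> = trop_eval a p + trop_eval a q"
    by (simp add: trop_eval_superset[of ?X])
  finally show ?thesis .
qed

lemma trop_eval_sum: "trop_eval a (\<Sum>i\<in>I. p i) = (\<Sum>i\<in>I. trop_eval a (p i))"
  by (induction I rule: infinite_finite_induct) (simp_all add: trop_eval_add)

text \<open>The summands of \<open>word_poly\<close> are single monomials with coefficient 1; this
  relation carries their values through products and powers, so only additivity of
  \<open>trop_eval\<close> is proved for general polynomials.\<close>

definition is_monomial :: "('x \<Rightarrow> trop) \<Rightarrow> 'x trop_poly \<Rightarrow> trop \<Rightarrow> bool" where
  "is_monomial a p c \<longleftrightarrow> (\<exists>m. p = Poly_Mapping.single m 1 \<and> mono_eval a m = c)"

lemma is_monomial_trop_eval: "is_monomial a p c \<Longrightarrow> trop_eval a p = c"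
  by (auto simp: is_monomial_def trop_eval_def mono_eval_def)

lemma is_monomial_one: "is_monomial a 1 1"
  unfolding is_monomial_def by (intro exI[of _ 0]) simp

lemma is_monomial_mult: "is_monomial a p c \<Longrightarrow> is_monomial a q d \<Longrightarrow> is_monomial a (p * q) (c * d)"
  unfolding is_monomial_def by (metis mono_eval_add mult_single mult_1)

lemma is_monomial_trop_var: "is_monomial a (trop_var x) (a x)"
  unfolding is_monomial_def trop_var_def
  by (intro exI[of _ "Poly_Mapping.single x 1"]) (simp add: mono_eval_def)

lemma is_monomial_power: "is_monomial a p c \<Longrightarrow> is_monomial a (p ^ k) (c ^ k)"
  by (induction k) (simp_all add: is_monomial_one is_monomial_mult)

lemma is_monomial_prod:
  "(\<And>i. is_monomial a (p i) (c i)) \<Longrightarrow> is_monomial a (\<Prod>i\<in>I. p i) (\<Prod>i\<in>I. c i)"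
  by (induction I rule: infinite_finite_induct) (simp_all add: is_monomial_one is_monomial_mult)

definition block_val :: "('s::finite \<times> 'g \<Rightarrow> trop) \<Rightarrow> 's list \<Rightarrow> 'g \<Rightarrow> nat \<Rightarrow> nat \<Rightarrow> trop" where
  "block_val a w r p q = (\<Prod>s\<in>UNIV. a (s, r) ^ \<beta> w s p q)"

text \<open>Exchanging the products over letters and over vertices groups the factors by the blocks
  between consecutive markers.\<close>

lemma trop_eval_word_poly:
  "trop_eval a (word_poly u \<rho> w) =
    (\<Sum>\<alpha>\<in>occurrences u w. \<Prod>k=0..length u. block_val a w (\<rho> ! k) (\<alpha> ! k) (\<alpha> ! (k + 1)))"
proof -
  have "trop_eval a (\<Prod>s\<in>UNIV. \<Prod>k=0..length u. trop_var (s, \<rho> ! k) ^ \<beta> w s (\<alpha> ! k) (\<alpha> ! (k + 1))) =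
      (\<Prod>s\<in>UNIV. \<Prod>k=0..length u. a (s, \<rho> ! k) ^ \<beta> w s (\<alpha> ! k) (\<alpha> ! (k + 1)))" for \<alpha>
    by (intro is_monomial_trop_eval is_monomial_prod is_monomial_power is_monomial_trop_var)
  moreover have "(\<Prod>s\<in>UNIV. \<Prod>k=0..length u. a (s, \<rho> ! k) ^ \<beta> w s (\<alpha> ! k) (\<alpha> ! (k + 1))) =
      (\<Prod>k=0..length u. block_val a w (\<rho> ! k) (\<alpha> ! k) (\<alpha> ! (k + 1)))" for \<alpha>
    unfolding block_val_def by (rule prod.swap)
  ultimately show ?thesis by (simp add: word_poly_def trop_eval_sum)
qed

section \<open>Counts, blocks and occurrences in a word with a letter prepended\<close>

lemma letter_Cons: "letter (c # w) (Suc i) = (if i = 0 then c else letter w i)"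
  by (simp add: letter_def nth_Cons')

lemma \<beta>_Cons_Suc: "\<beta> (c # w) s (Suc p) (Suc q) = \<beta> w s p q"
proof -
  have "{i. Suc p < i \<and> i < Suc q \<and> letter (c # w) i = s} =
      Suc ` {i. p < i \<and> i < q \<and> letter w i = s}"
  proof (intro set_eqI iffI)
    fix i assume i: "i \<in> {i. Suc p < i \<and> i < Suc q \<and> letter (c # w) i = s}"
    then obtain l where "i = Suc l" by (cases i) auto
    with i show "i \<in> Suc ` {i. p < i \<and> i < q \<and> letter w i = s}" by (auto simp: letter_Cons)
  qed (auto simp: letter_Cons)
  then show ?thesis by (simp add: \<beta>_def card_image)
qed

text \<open>Compared with the block in \<open>w\<close>, this block gains position 1, which carries
  c; \<open>0 < q\<close> ensures that position 1 lies before \<open>Suc q\<close>.\<close>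

lemma \<beta>_Cons_zero:
  assumes "0 < q"
  shows "\<beta> (c # w) s 0 (Suc q) = (if s = c then Suc (\<beta> w s 0 q) else \<beta> w s 0 q)"
proof -
  let ?S = "{i. Suc 0 < i \<and> i < Suc q \<and> letter (c # w) i = s}"
  have "{i. 0 < i \<and> i < Suc q \<and> letter (c # w) i = s} = (if s = c then insert 1 ?S else ?S)"
  proof (intro set_eqI)
    fix i
    show "i \<in> {i. 0 < i \<and> i < Suc q \<and> letter (c # w) i = s} \<longleftrightarrow>
        i \<in> (if s = c then insert 1 ?S else ?S)"
      using assms by (cases "i = 1") (auto simp: letter_Cons)
  qed
  moreover have "finite ?S" "1 \<notin> ?S" by auto
  ultimately have "\<beta> (c # w) s 0 (Suc q) = (if s = c then Suc (card ?S) else card ?S)"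
    unfolding \<beta>_def by (cases "s = c") (simp_all only: card_insert_disjoint simp_thms if_True if_False)
  moreover have "card ?S = \<beta> w s 0 q"
    using \<beta>_Cons_Suc[of c w s 0 q] by (simp only: \<beta>_def)
  ultimately show ?thesis by (simp only:)
qed

lemma block_val_Cons_Suc: "block_val a (c # w) r (Suc p) (Suc q) = block_val a w r p q"
  by (simp add: block_val_def \<beta>_Cons_Suc)

lemma block_val_Cons_zero:
  assumes "0 < q"
  shows "block_val a (c # w) r 0 (Suc q) = a (c, r) * block_val a w r 0 q"
proof -
  have "block_val a (c # w) r 0 (Suc q) =
      (\<Prod>s\<in>UNIV. (if s = c then a (c, r) else 1) * a (s, r) ^ \<beta> w s 0 q)"
    unfolding block_val_def by (intro prod.cong) (auto simp: \<beta>_Cons_zero[OF assms])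
  then show ?thesis by (simp add: prod.distrib block_val_def)
qed

lemma block_val_adjacent: "block_val a w r p (Suc p) = 1"
proof -
  have "\<beta> w s p (Suc p) = 0" for s by (auto simp: \<beta>_def)
  then show ?thesis by (simp add: block_val_def)
qed

text \<open>Between the leading 0 and the end marker stand exactly the marked positions, aligned
  with u; \<open>list_all2\<close> also encodes the length condition and suits recursion.\<close>

lemma occurrences_Cons_iff:
  "0 # \<alpha> \<in> occurrences u w \<longleftrightarrow> \<alpha> \<noteq> [] \<and> sorted_wrt (<) (0 # \<alpha>) \<and> last \<alpha> = length w + 1 \<and>
    list_all2 (\<lambda>i s. letter w i = s) (butlast \<alpha>) u"
proof -
  have "(\<forall>k\<in>{1..length u}. letter w ((0 # \<alpha>) ! k) = letter u k) \<longleftrightarrow>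
      (\<forall>k<length u. letter w (\<alpha> ! k) = u ! k)"
    by (force simp: letter_def)
  moreover have "last \<alpha> = \<alpha> ! length u" if "length \<alpha> = Suc (length u)"
    using that by (subst last_conv_nth) auto
  ultimately show ?thesis
    by (cases "length \<alpha> = Suc (length u)")
      (auto simp: occurrences_def list_all2_conv_all_nth nth_butlast,
       metis Suc_pred length_greater_0_conv)
qed

lemma occurrences_hd: "\<alpha> \<in> occurrences u w \<Longrightarrow> \<exists>\<alpha>'. \<alpha> = 0 # \<alpha>'"
  by (cases \<alpha>) (auto simp: occurrences_def)

lemma occurrences_Nil: "occurrences u [] = (if u = [] then {[0, 1]} else {})"
proof -
  have "\<alpha> \<in> occurrences u [] \<longleftrightarrow> u = [] \<and> \<alpha> = [0, 1]" for \<alpha>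
  proof
    assume \<alpha>: "\<alpha> \<in> occurrences u []"
    then obtain \<alpha>' where "\<alpha> = 0 # \<alpha>'" using occurrences_hd by blast
    with \<alpha> show "u = [] \<and> \<alpha> = [0, 1]"
      by (cases \<alpha>' rule: rev_cases; cases "butlast \<alpha>'")
         (auto simp: occurrences_Cons_iff sorted_wrt_append)
  qed (simp add: occurrences_Cons_iff)
  then show ?thesis by auto
qed

text \<open>A 0 in the list would become position 1, where the longer word has its new letter
  c.\<close>

lemma list_all2_letter_Cons:
  assumes "0 \<notin> set xs"
  shows "list_all2 (\<lambda>i s. letter (c # w) i = s) (map Suc xs) u \<longleftrightarrow>
    list_all2 (\<lambda>i s. letter w i = s) xs u"
  using assms by (force simp: list_all2_conv_all_nth letter_Cons in_set_conv_nth)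

text \<open>
  Either the first letter of the word is not marked, or it is marked as the first letter of the
  subword; the marker after the leading one then has position 1.
\<close>

lemma occurrences_Cons_word_iff:
  "0 # map Suc \<alpha> \<in> occurrences u (c # w) \<longleftrightarrow>
    0 # \<alpha> \<in> occurrences u w \<or> u \<noteq> [] \<and> hd u = c \<and> \<alpha> \<in> occurrences (tl u) w"
proof (cases \<alpha>)
  case Nil
  then show ?thesis by (auto simp: occurrences_def)
next
  case (Cons b bs)
  have srt: "sorted_wrt (<) (map Suc \<alpha>) \<longleftrightarrow> sorted_wrt (<) \<alpha>"
    by (simp add: sorted_wrt_map)
  show ?thesis
  \<comment> \<open>For b = 0 only the alternative with \<open>tl u\<close> is possible, since
    \<open>0 # \<alpha>\<close> is not strictly increasing; otherwise only the other one, since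
    \<alpha> does not start with 0.\<close>
  proof (cases "b = 0")
    case True
    have no: "0 # \<alpha> \<notin> occurrences u w"
      using True Cons by (simp add: occurrences_Cons_iff)
    show ?thesis
    proof (cases "sorted_wrt (<) \<alpha> \<and> bs \<noteq> [] \<and> u \<noteq> []")
      case s: True
      then obtain s u' where u: "u = s # u'" by (cases u) auto
      have "0 \<notin> set (butlast bs)" using s True Cons by (auto dest: in_set_butlastD)
      from list_all2_letter_Cons[OF this, of c w u'] show ?thesis
        using s True Cons u no srt
        by (auto simp: occurrences_Cons_iff map_butlast[symmetric] last_map letter_Cons)
    next
      case False
      then show ?thesis
        using True Cons no srt
        by (cases u; cases bs) (auto simp: occurrences_Cons_iff)
    qed
  next
    case False
    have no: "\<alpha> \<notin> occurrences (tl u) w"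
      using False Cons by (auto simp: occurrences_def)
    have "0 \<notin> set (butlast \<alpha>)" if "sorted_wrt (<) \<alpha>"
      using that False Cons by (auto dest!: in_set_butlastD)
    note list_all2_letter_Cons[OF this, of c w u]
    moreover have "sorted_wrt (<) (0 # \<alpha>) \<longleftrightarrow> sorted_wrt (<) \<alpha>"
      using False Cons by auto
    ultimately show ?thesis
      using no srt Cons by (auto simp: occurrences_Cons_iff map_butlast[symmetric] last_map)
  qed
qed

text \<open>An unmarked first letter shifts every marker but the leading 0, hence \<open>tl\<close>;
  a marked one turns the old leading 0 into the marker 1.\<close>

lemma occurrences_Cons_word:
  "occurrences u (c # w) = (\<lambda>\<alpha>. 0 # map Suc (tl \<alpha>)) ` occurrences u w \<union>
    (if u \<noteq> [] \<and> hd u = c then (\<lambda>\<alpha>. 0 # map Suc \<alpha>) ` occurrences (tl u) w else {})"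
    (is "_ = ?A \<union> ?B")
proof (intro set_eqI iffI)
  fix \<alpha> assume \<alpha>: "\<alpha> \<in> occurrences u (c # w)"
  then obtain \<gamma> where \<gamma>: "\<alpha> = 0 # \<gamma>" using occurrences_hd by blast
  \<comment> \<open>Strict monotonicity makes all entries after the leading 0 positive, so \<gamma>
    is the shift of its predecessors.\<close>
  then have "0 \<notin> set \<gamma>" using \<alpha> by (auto simp: occurrences_def)
  then have "map Suc (map (\<lambda>i. i - 1) \<gamma>) = \<gamma>"
    by (auto intro!: map_idI Suc_pred intro: gr0I)
  then obtain \<delta> where \<delta>: "\<gamma> = map Suc \<delta>" by metis
  show "\<alpha> \<in> ?A \<union> ?B"
    using \<alpha> occurrences_Cons_word_iff[of \<delta> u c w]
    by (auto simp: \<gamma> \<delta> intro: image_eqI[where x = "0 # \<delta>"])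
next
  fix \<alpha> assume "\<alpha> \<in> ?A \<union> ?B"
  then show "\<alpha> \<in> occurrences u (c # w)"
    using occurrences_hd[of _ u w] occurrences_Cons_word_iff[of _ u c w]
    by (fastforce split: if_splits)
qed

text \<open>With the current vertex at the head of \<rho>, the same two cases become a recursion. A
  letter read at that vertex contributes a factor; a marked letter contributes none, its weight
  being kept apart in \<open>path_weight\<close>.\<close>

primrec word_val :: "('s \<times> 'g \<Rightarrow> trop) \<Rightarrow> 's list \<Rightarrow> 'g list \<Rightarrow> 's list \<Rightarrow> trop" where
  "word_val a u \<rho> [] = (if u = [] then 1 else 0)"
| "word_val a u \<rho> (c # w) = a (c, hd \<rho>) * word_val a u \<rho> w +
    (if u \<noteq> [] \<and> hd u = c then word_val a (tl u) (tl \<rho>) w else 0)"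

lemma word_val_eq_sum_occurrences:
  fixes u :: "'s::finite list"
  assumes "length \<rho> = length u + 1"
  shows "(\<Sum>\<alpha>\<in>occurrences u w. \<Prod>k=0..length u. block_val a w (\<rho> ! k) (\<alpha> ! k) (\<alpha> ! (k + 1)))
    = word_val a u \<rho> w"
  using assms
proof (induction w arbitrary: u \<rho>)
  case Nil
  then show ?case
    using block_val_adjacent[of a "[]" _ 0] by (simp add: occurrences_Nil)
next
  case (Cons c w)
  define T where "T w u \<rho> \<alpha> = (\<Prod>k=0..length u. block_val a w (\<rho> ! k) (\<alpha> ! k) (\<alpha> ! (k + 1)))"
    for w u :: "'s list" and \<rho> \<alpha>
  let ?f = "\<lambda>\<alpha>::nat list. 0 # map Suc (tl \<alpha>)" and ?g = "\<lambda>\<alpha>::nat list. 0 # map Suc \<alpha>"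
  let ?B = "if u \<noteq> [] \<and> hd u = c then ?g ` occurrences (tl u) w else {}"
  obtain r \<rho>' where \<rho>: "\<rho> = r # \<rho>'" using Cons.prems by (cases \<rho>) auto
  \<comment> \<open>Only the first block gains a letter; the others are merely shifted.\<close>
  have Tf: "T (c # w) u \<rho> (?f \<alpha>) = a (c, hd \<rho>) * T w u \<rho> \<alpha>" if "\<alpha> \<in> occurrences u w" for \<alpha>
  proof -
    have len: "length \<alpha> = length u + 2" and z: "\<alpha> ! 0 = 0"
      using that by (auto simp: occurrences_def)
    have pos: "0 < \<alpha> ! 1"
      using that z sorted_wrt_nth_less[of "(<)" \<alpha> 0 1] by (simp add: occurrences_def)
    have nz: "?f \<alpha> ! Suc k = Suc (\<alpha> ! Suc k)" if "k \<le> length u" for k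
      using len that by (simp add: nth_tl)
    let ?p = "\<lambda>k. block_val a (c # w) (\<rho> ! k) (?f \<alpha> ! k) (?f \<alpha> ! (k + 1))"
    let ?q = "\<lambda>k. block_val a w (\<rho> ! k) (\<alpha> ! k) (\<alpha> ! (k + 1))"
    have "T (c # w) u \<rho> (?f \<alpha>) = ?p 0 * prod ?p {Suc 0..length u}"
      unfolding T_def by (rule prod.atLeast_Suc_atMost) simp
    also have "?p 0 = a (c, hd \<rho>) * ?q 0"
      using pos z nz[of 0] by (simp add: \<rho> block_val_Cons_zero)
    also have "prod ?p {Suc 0..length u} = prod ?q {Suc 0..length u}"
    proof (rule prod.cong)
      fix k assume "k \<in> {Suc 0..length u}"
      then obtain l where "k = Suc l" "Suc l \<le> length u" by (cases k) auto
      then show "?p k = ?q k"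
        using nz[of l] nz[of "Suc l"] by (simp add: block_val_Cons_Suc del: nth_Cons_Suc)
    qed simp
    also have "a (c, hd \<rho>) * ?q 0 * prod ?q {Suc 0..length u} =
        a (c, hd \<rho>) * (?q 0 * prod ?q {Suc 0..length u})"
      by (rule mult.assoc)
    also have "?q 0 * prod ?q {Suc 0..length u} = T w u \<rho> \<alpha>"
      unfolding T_def by (rule prod.atLeast_Suc_atMost[symmetric]) simp
    finally show ?thesis .
  qed
  \<comment> \<open>Marking position 1 puts an empty block, of value 1, in front of the blocks of
    \<alpha>.\<close>
  have Tg: "T (c # w) u \<rho> (?g \<alpha>) = T w (tl u) (tl \<rho>) \<alpha>"
    if \<alpha>: "\<alpha> \<in> occurrences (tl u) w" and "u \<noteq> []" for \<alpha>
  proof -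
    obtain s u' where u: "u = s # u'" using \<open>u \<noteq> []\<close> by (cases u) auto
    have len: "length \<alpha> = length u' + 2" and z: "\<alpha> ! 0 = 0"
      using \<alpha> u by (auto simp: occurrences_def)
    have "T (c # w) u \<rho> (?g \<alpha>) = block_val a (c # w) r 0 (Suc 0) *
        (\<Prod>k=0..length u'. block_val a (c # w) (\<rho>' ! k) (Suc (\<alpha> ! k)) (Suc (\<alpha> ! Suc k)))"
      unfolding T_def u using len z
      by (simp add: prod.atLeast0_atMost_Suc_shift \<rho> del: prod.cl_ivl_Suc)
    then show ?thesis by (simp add: T_def u \<rho> block_val_Cons_Suc block_val_adjacent)
  qed
  \<comment> \<open>The entry after the leading 0 is at least 2 in the images under
    \<open>?f\<close> and equal to 1 in those under \<open>?g\<close>.\<close>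
  have disj: "?f ` occurrences u w \<inter> ?B = {}"
  proof -
    have "?f \<alpha> \<noteq> ?g \<gamma>" if "\<alpha> \<in> occurrences u w" "\<gamma> \<in> occurrences (tl u) w" for \<alpha> \<gamma>
      using that occurrences_hd[OF that(1)] occurrences_hd[OF that(2)]
      by (auto simp: occurrences_Cons_iff inj_map_eq_map)
    then show ?thesis by auto
  qed
  have "(\<Sum>\<alpha>\<in>occurrences u (c # w). T (c # w) u \<rho> \<alpha>) =
      sum (T (c # w) u \<rho>) (?f ` occurrences u w) + sum (T (c # w) u \<rho>) ?B"
    unfolding occurrences_Cons_word
    by (rule sum.union_disjoint) (use disj in \<open>auto intro: finite_occurrences\<close>)
  also have "sum (T (c # w) u \<rho>) (?f ` occurrences u w) = (\<Sum>\<alpha>\<in>occurrences u w. T (c # w) u \<rho> (?f \<alpha>))"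
  proof (subst sum.reindex)
    show "inj_on ?f (occurrences u w)"
      by (rule inj_onI) (auto dest!: occurrences_hd simp: inj_map_eq_map)
  qed simp
  also have "\<dots> = a (c, hd \<rho>) * (\<Sum>\<alpha>\<in>occurrences u w. T w u \<rho> \<alpha>)"
    by (simp add: Tf sum_distrib_left)
  also have "\<dots> = a (c, hd \<rho>) * word_val a u \<rho> w"
    unfolding T_def by (simp only: Cons.IH Cons.prems)
  also have "sum (T (c # w) u \<rho>) ?B = (if u \<noteq> [] \<and> hd u = c then word_val a (tl u) (tl \<rho>) w else 0)"
  proof (cases "u \<noteq> [] \<and> hd u = c")
    case True
    then have "sum (T (c # w) u \<rho>) ?B = (\<Sum>\<alpha>\<in>occurrences (tl u) w. T (c # w) u \<rho> (?g \<alpha>))"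
      by (simp add: sum.reindex inj_on_def inj_map_eq_map)
    also have "\<dots> = (\<Sum>\<alpha>\<in>occurrences (tl u) w. T w (tl u) (tl \<rho>) \<alpha>)"
      using True by (simp add: Tg)
    also have "\<dots> = word_val a (tl u) (tl \<rho>) w"
      unfolding T_def by (rule Cons.IH) (use True Cons.prems in \<open>cases u; simp\<close>)
    finally show ?thesis using True by simp
  qed auto
  finally show ?case unfolding T_def by simp
qed

lemma trop_eval_word_poly_eq_word_val:
  "length \<rho> = length u + 1 \<Longrightarrow> trop_eval a (word_poly u \<rho> w) = word_val a u \<rho> w"
  by (simp only: trop_eval_word_poly word_val_eq_sum_occurrences)

section \<open>Matrix entries as suprema over paths\<close>

fun path_weight :: "('s \<Rightarrow> 'g trop_matrix) \<Rightarrow> 's list \<Rightarrow> 'g list \<Rightarrow> trop" where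
  "path_weight A [] \<rho> = 1"
| "path_weight A (s # u) \<rho> = A s (hd \<rho>) (hd (tl \<rho>)) * path_weight A u (tl \<rho>)"

abbreviation diagonal :: "('s \<Rightarrow> 'g trop_matrix) \<Rightarrow> 's \<times> 'g \<Rightarrow> trop" where
  "diagonal A \<equiv> \<lambda>(s, i). A s i i"

text \<open>Each summand of \<open>word_val\<close> is matched with one term of the matrix product:
  staying with k the head of \<rho>, moving with k its next vertex.\<close>

lemma path_weight_word_val_le:
  fixes A :: "'s \<Rightarrow> 'g::order trop_matrix"
  assumes A: "\<And>s. A s \<in> chain_matrices \<Gamma>"
    and "length \<rho> = length u + 1" "set \<rho> \<subseteq> \<Gamma>"
  shows "path_weight A u \<rho> * word_val (diagonal A) u \<rho> w \<le> word_matrix \<Gamma> A w (hd \<rho>) (last \<rho>)"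
  using assms(2,3)
proof (induction w arbitrary: u \<rho>)
  \<comment> \<open>For the empty word only u = [] has a value other than minus infinity; then
    \<rho> is a single vertex, on the diagonal of the identity matrix.\<close>
  case Nil
  then show ?case by (cases \<rho>) (auto simp: id_matrix_def zero_trop_def)
next
  case (Cons c w)
  obtain r \<rho>' where \<rho>: "\<rho> = r # \<rho>'" using Cons.prems by (cases \<rho>) auto
  have step: "A c r k * word_matrix \<Gamma> A w k (last \<rho>) \<le> word_matrix \<Gamma> A (c # w) r (last \<rho>)"
    if "k \<in> \<Gamma>" for k
    using that by (simp add: mult_le_matrix_mult A word_matrix_closed)
  have "path_weight A u \<rho> * (A c r r * word_val (diagonal A) u \<rho> w) =
      A c r r * (path_weight A u \<rho> * word_val (diagonal A) u \<rho> w)"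
    by (simp add: ac_simps)
  also have "\<dots> \<le> A c r r * word_matrix \<Gamma> A w r (last \<rho>)"
    using Cons.IH[OF Cons.prems] by (intro trop_mult_mono order.refl) (simp add: \<rho>)
  also have "\<dots> \<le> word_matrix \<Gamma> A (c # w) r (last \<rho>)"
    using Cons.prems by (intro step) (simp add: \<rho>)
  finally have stay: "path_weight A u \<rho> * (A c r r * word_val (diagonal A) u \<rho> w)
      \<le> word_matrix \<Gamma> A (c # w) r (last \<rho>)" .
  have move: "path_weight A u \<rho> * word_val (diagonal A) (tl u) (tl \<rho>) w
      \<le> word_matrix \<Gamma> A (c # w) r (last \<rho>)" if c: "u \<noteq> []" "hd u = c"
  proof -
    obtain u' where u: "u = c # u'" using c by (cases u) auto
    obtain r' \<rho>'' where \<rho>': "\<rho>' = r' # \<rho>''" using Cons.prems u \<rho> by (cases \<rho>') auto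
    have "path_weight A u \<rho> * word_val (diagonal A) (tl u) (tl \<rho>) w =
        A c r r' * (path_weight A u' \<rho>' * word_val (diagonal A) u' \<rho>' w)"
      by (simp add: u \<rho> \<rho>' ac_simps)
    also have "\<dots> \<le> A c r r' * word_matrix \<Gamma> A w r' (last \<rho>)"
      using Cons.IH[of \<rho>' u'] Cons.prems
      by (intro trop_mult_mono order.refl) (simp add: u \<rho> \<rho>')
    also have "\<dots> \<le> word_matrix \<Gamma> A (c # w) r (last \<rho>)"
      using Cons.prems by (intro step) (simp add: \<rho> \<rho>')
    finally show ?thesis .
  qed
  show ?case
    using stay move
    by (auto simp: \<rho> distrib_left trop_add_le_iff zero_trop_def simp del: word_matrix.simps)
qed

text \<open>This expresses the least upper bound property without forming a supremum over paths. The
  induction must allow any x, since x takes up the entry of each letter split off.\<close>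

lemma word_matrix_least:
  fixes A :: "'s \<Rightarrow> 'g::order trop_matrix"
  assumes A: "\<And>s. A s \<in> chain_matrices \<Gamma>" and "i \<in> \<Gamma>" "j \<in> \<Gamma>"
    and "\<And>u \<rho>. is_path \<Gamma> (length u + 1) \<rho> \<Longrightarrow> hd \<rho> = i \<Longrightarrow> last \<rho> = j \<Longrightarrow>
      x * (path_weight A u \<rho> * word_val (diagonal A) u \<rho> w) \<le> z"
  shows "x * word_matrix \<Gamma> A w i j \<le> z"
  using assms(2-)
proof (induction w arbitrary: i x)
  case Nil
  show ?case
  proof (cases "i = j")
    case True
    then show ?thesis
      using Nil.prems(3)[of "[]" "[i]"] Nil.prems(1) by (simp add: is_path_def id_matrix_def)
  qed (simp add: id_matrix_def)
next
  case (Cons c w)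
  have "x * (A c i k * word_matrix \<Gamma> A w k j) \<le> z" if k: "k \<in> \<Gamma>" for k
  proof (cases "A c i k = MInf")
    case False
    then have ik: "i \<le> k" using chain_matrices_support[OF A] by blast
    have "(x * A c i k) * word_matrix \<Gamma> A w k j \<le> z"
    proof (rule Cons.IH[OF k Cons.prems(2)])
      fix u :: "'s list" and \<rho>
      assume \<rho>: "is_path \<Gamma> (length u + 1) \<rho>" "hd \<rho> = k" "last \<rho> = j"
      let ?v = "word_val (diagonal A) u \<rho> w"
      show "x * A c i k * (path_weight A u \<rho> * ?v) \<le> z"
      proof (cases "i = k")
        case True
        have "x * A c i k * (path_weight A u \<rho> * ?v) = x * (path_weight A u \<rho> * (A c i k * ?v))"
          by (simp add: ac_simps)
        also have "\<dots> \<le> x * (path_weight A u \<rho> * word_val (diagonal A) u \<rho> (c # w))"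
          using \<rho>(2) True by (intro trop_mult_mono order.refl) (simp add: plus_trop_def)
        also have "\<dots> \<le> z"
          using \<rho> True by (intro Cons.prems(3)) auto
        finally show ?thesis .
      next
        case False
        \<comment> \<open>Here i < k, and k is the least vertex of \<rho>, so
          \<open>i # \<rho>\<close> is again a path, with the label c for the new step.\<close>
        obtain r \<rho>' where r: "\<rho> = r # \<rho>'" using \<rho>(1) by (cases \<rho>) (auto simp: is_path_def)
        then have "is_path \<Gamma> (length (c # u) + 1) (i # \<rho>)"
          using \<rho> False ik Cons.prems(1) by (fastforce simp: is_path_def)
        moreover have "last (i # \<rho>) = j" using \<rho>(3) r by simp
        ultimately have le: "x * (path_weight A (c # u) (i # \<rho>) *
            word_val (diagonal A) (c # u) (i # \<rho>) (c # w)) \<le> z"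
          by (intro Cons.prems(3)) auto
        have "x * A c i k * (path_weight A u \<rho> * ?v) = x * (path_weight A (c # u) (i # \<rho>) * ?v)"
          using \<rho>(2) by (simp add: ac_simps)
        also have "\<dots> \<le> x * (path_weight A (c # u) (i # \<rho>) *
            word_val (diagonal A) (c # u) (i # \<rho>) (c # w))"
          by (intro trop_mult_mono order.refl) (simp add: plus_trop_def)
        also note le
        finally show ?thesis .
      qed
    qed
    then show ?thesis by (simp add: ac_simps)
  qed simp
  then show ?case by (auto intro: mult_matrix_mult_le)
qed

text \<open>Every path term for w equals the one for v, which lies below the entry of v; the
  converse inequality comes by exchanging the words.\<close>

lemma word_matrix_le:
  fixes A :: "'s \<Rightarrow> 'g::order trop_matrix"
  assumes A: "\<And>s. A s \<in> chain_matrices \<Gamma>"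
    and eq: "\<And>u \<rho>. is_path \<Gamma> (length u + 1) \<rho> \<Longrightarrow>
      word_val (diagonal A) u \<rho> w = word_val (diagonal A) u \<rho> v"
  shows "word_matrix \<Gamma> A w i j \<le> word_matrix \<Gamma> A v i j"
proof (cases "word_matrix \<Gamma> A w i j = MInf")
  case False
  have "word_matrix \<Gamma> A w \<in> chain_matrices \<Gamma>" by (rule word_matrix_closed[OF A])
  then have ij: "i \<in> \<Gamma>" "j \<in> \<Gamma>" using chain_matrices_support False by blast+
  have "1 * word_matrix \<Gamma> A w i j \<le> word_matrix \<Gamma> A v i j"
  proof (rule word_matrix_least[OF A ij])
    fix u :: "'s list" and \<rho>
    assume \<rho>: "is_path \<Gamma> (length u + 1) \<rho>" "hd \<rho> = i" "last \<rho> = j"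
    have "path_weight A u \<rho> * word_val (diagonal A) u \<rho> v \<le> word_matrix \<Gamma> A v (hd \<rho>) (last \<rho>)"
      using \<rho>(1) by (intro path_weight_word_val_le A) (auto simp: is_path_def)
    then show "1 * (path_weight A u \<rho> * word_val (diagonal A) u \<rho> w) \<le> word_matrix \<Gamma> A v i j"
      by (simp add: eq[OF \<rho>(1)] \<rho>(2,3))
  qed
  then show ?thesis by simp
qed simp

section \<open>Matrices realising a given polynomial\<close>

text \<open>Zipping u with the pairs of consecutive vertices ties each step of \<rho> to its own
  letter. The diagonal is cut down to \<rho> because \<open>a\<close> may be unbounded on an
  infinite \<Gamma>.\<close>

definition path_matrix ::
  "('s \<times> 'g \<Rightarrow> trop) \<Rightarrow> 's list \<Rightarrow> 'g list \<Rightarrow> 's \<Rightarrow> 'g trop_matrix" where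
  "path_matrix a u \<rho> s i j =
    (if i = j then if i \<in> set \<rho> then a (s, i) else MInf
     else if (s, i, j) \<in> set (zip u (zip \<rho> (tl \<rho>))) then 1 else MInf)"

lemma in_zip_consecutive:
  assumes "is_path \<Gamma> m \<rho>" "(s, i, j) \<in> set (zip u (zip \<rho> (tl \<rho>)))"
  shows "i \<in> \<Gamma> \<and> j \<in> \<Gamma> \<and> i < j"
proof -
  have "(i, j) \<in> set (zip \<rho> (tl \<rho>))" using assms(2) by (meson in_set_zipE)
  then obtain k where k: "i = \<rho> ! k" "j = \<rho> ! Suc k" "Suc k < length \<rho>"
    by (auto simp: in_set_zip nth_tl)
  then have "i \<le> j" "i \<noteq> j"
    using assms(1) by (auto simp: is_path_def sorted_wrt_iff_nth_less nth_eq_iff_index_eq)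
  moreover have "i \<in> \<Gamma>" "j \<in> \<Gamma>"
    using assms(1) k by (auto simp: is_path_def)
  ultimately show ?thesis by simp
qed

lemma path_matrix_closed:
  assumes "is_path \<Gamma> m \<rho>"
  shows "path_matrix a u \<rho> s \<in> chain_matrices \<Gamma>"
proof (rule chain_matricesI)
  \<comment> \<open>A finite set that contains every entry, so its maximum is a bound.\<close>
  let ?V = "{MInf, 1} \<union> (\<lambda>i. a (s, i)) ` set \<rho>"
  show "path_matrix a u \<rho> s i j \<le> Max ?V" for i j
    by (intro Max_ge) (auto simp: path_matrix_def)
  show "i \<in> \<Gamma> \<and> j \<in> \<Gamma> \<and> i \<le> j" if "path_matrix a u \<rho> s i j \<noteq> MInf" for i j
    using that assms in_zip_consecutive[OF assms, of s i j u]
    by (auto simp: path_matrix_def is_path_def less_imp_le split: if_splits)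
qed

lemma path_weight_path_matrix:
  assumes "is_path \<Gamma> m \<rho>" and "length \<rho> = length u + 1"
  shows "path_weight (path_matrix a u \<rho>) u \<rho> = 1"
proof -
  \<comment> \<open>Generalised so as to cover final segments, because \<open>path_weight\<close>
    consumes its lists while the matrices remain fixed.\<close>
  have "path_weight (path_matrix a u \<rho>) u' \<rho>' = 1"
    if "set (zip u' (zip \<rho>' (tl \<rho>'))) \<subseteq> set (zip u (zip \<rho> (tl \<rho>)))" "length \<rho>' = length u' + 1"
    for u' \<rho>'
    using that
  proof (induction u' arbitrary: \<rho>')
    case (Cons s u')
    obtain i j \<rho>'' where \<rho>': "\<rho>' = i # j # \<rho>''"
      using Cons.prems(2) by (cases \<rho>'; cases "tl \<rho>'") auto
    then have "(s, i, j) \<in> set (zip u (zip \<rho> (tl \<rho>)))" using Cons.prems(1) by auto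
    then have "path_matrix a u \<rho> s i j = 1"
      using in_zip_consecutive[OF assms(1), of s i j u] by (auto simp: path_matrix_def)
    then show ?case using Cons.IH[of "j # \<rho>''"] Cons.prems \<rho>' by auto
  qed simp
  then show ?thesis using assms(2) by blast
qed

text \<open>As \<rho> has no repeated vertex, at most one labelled step leaves each of its vertices,
  so a path of finite weight must follow \<rho>, and the common end fixes where it stops. The first
  hypothesis speaks only of vertices of \<rho>, so that it survives removing the first
  vertex.\<close>

lemma path_weight_nonzero_unique:
  assumes "\<And>s i j. i \<in> set \<rho> \<Longrightarrow> i \<noteq> j \<Longrightarrow> A s i j \<noteq> MInf \<Longrightarrow> (s, i, j) \<in> set (zip u (zip \<rho> (tl \<rho>)))"
    and "length \<rho> = length u + 1" "distinct \<rho>"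
    and "length \<rho>' = length u' + 1" "distinct \<rho>'"
    and "hd \<rho>' = hd \<rho>" "last \<rho>' = last \<rho>" "path_weight A u' \<rho>' \<noteq> MInf"
  shows "u' = u \<and> \<rho>' = \<rho>"
  using assms
proof (induction u arbitrary: \<rho> u' \<rho>')
  case Nil
  obtain r where r: "\<rho> = [r]" using Nil.prems(2) by (cases \<rho>) auto
  obtain r' \<rho>'' where "\<rho>' = r' # \<rho>''" using Nil.prems(4) by (cases \<rho>') auto
  with r Nil.prems(4-7) show ?case by (auto split: if_splits)
next
  case (Cons s u)
  obtain r q \<rho>1 where \<rho>: "\<rho> = r # q # \<rho>1"
    using Cons.prems(2) by (cases \<rho>; cases "tl \<rho>") auto
  obtain r' \<rho>2 where \<rho>': "\<rho>' = r' # \<rho>2" using Cons.prems(4) by (cases \<rho>') auto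
  have r': "r' = r" using Cons.prems(6) \<rho> \<rho>' by simp
  \<comment> \<open>With \<open>\<rho>2\<close> empty the path would end at r, which is not the last
    vertex of \<rho> by distinctness.\<close>
  have "\<rho>2 \<noteq> []" using Cons.prems(3,7) \<rho> \<rho>' r' by (auto split: if_splits)
  then obtain q' \<rho>3 where \<rho>2: "\<rho>2 = q' # \<rho>3" by (cases \<rho>2) auto
  obtain s' u2 where u': "u' = s' # u2" using Cons.prems(4) \<rho>' \<rho>2 by (cases u') auto
  have "A s' r q' \<noteq> MInf" "r \<noteq> q'"
    using Cons.prems(5,8) \<rho>' r' \<rho>2 u' by auto
  then have "(s', r, q') \<in> set (zip (s # u) (zip \<rho> (tl \<rho>)))"
    using Cons.prems(1)[of r q' s'] \<rho> by simp
  \<comment> \<open>No later step of \<rho> starts at r again, so only the first triple is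
    left.\<close>
  moreover have "(s', r, q') \<notin> set (zip u (zip (q # \<rho>1) \<rho>1))"
    using Cons.prems(3) \<rho> by (auto elim!: in_set_zipE)
  ultimately have sq: "s' = s" "q' = q"
    by (auto simp: \<rho>)
  have "u2 = u \<and> \<rho>2 = q # \<rho>1"
  proof (rule Cons.IH)
    fix t i j assume i: "i \<in> set (q # \<rho>1)" "i \<noteq> j" "A t i j \<noteq> MInf"
    then have "(t, i, j) \<in> set (zip (s # u) (zip \<rho> (tl \<rho>)))"
      using Cons.prems(1)[of i j t] \<rho> by simp
    moreover have "i \<noteq> r" using i(1) Cons.prems(3) \<rho> by auto
    ultimately show "(t, i, j) \<in> set (zip u (zip (q # \<rho>1) (tl (q # \<rho>1))))"
      using \<rho> by auto
  qed (use Cons.prems \<rho> \<rho>' \<rho>2 u' sq in auto)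
  then show ?case using \<rho> \<rho>' r' u' sq by simp
qed

text \<open>Applied to the diagonal of \<open>path_matrix\<close>, which is guaranteed to agree with
  \<open>a\<close> only on the vertices of \<rho>.\<close>

lemma word_val_cong:
  assumes "\<And>s i. i \<in> set \<rho> \<Longrightarrow> a (s, i) = b (s, i)" "length \<rho> = length u + 1"
  shows "word_val a u \<rho> w = word_val b u \<rho> w"
  using assms
proof (induction w arbitrary: u \<rho>)
  case (Cons c w)
  have "word_val a (tl u) (tl \<rho>) w = word_val b (tl u) (tl \<rho>) w" if "u \<noteq> []"
    using Cons.prems that by (intro Cons.IH) (cases \<rho>; cases u; auto)+
  moreover have "hd \<rho> \<in> set \<rho>" using Cons.prems(2) by (cases \<rho>) auto
  ultimately show ?case using Cons.IH[OF Cons.prems] Cons.prems(1) by simp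
qed simp

text \<open>The lower bound is the term of \<rho> itself, of weight 1; every other labelled path
  with the same ends has weight minus infinity.\<close>

lemma word_matrix_path_matrix:
  fixes u :: "'s list"
  assumes \<rho>: "is_path \<Gamma> (length u + 1) \<rho>"
  shows "word_matrix \<Gamma> (path_matrix a u \<rho>) w (hd \<rho>) (last \<rho>) = word_val a u \<rho> w"
proof -
  let ?A = "path_matrix a u \<rho>"
  have len: "length \<rho> = length u + 1" and dist: "distinct \<rho>" and sub: "set \<rho> \<subseteq> \<Gamma>" and ne: "\<rho> \<noteq> []"
    using \<rho> by (auto simp: is_path_def)
  have A: "?A s \<in> chain_matrices \<Gamma>" for s by (rule path_matrix_closed[OF \<rho>])
  have ends: "hd \<rho> \<in> \<Gamma>" "last \<rho> \<in> \<Gamma>" using sub ne by auto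
  have wt: "path_weight ?A u \<rho> = 1" by (rule path_weight_path_matrix[OF \<rho> len])
  have "1 * word_matrix \<Gamma> ?A w (hd \<rho>) (last \<rho>) \<le> word_val (diagonal ?A) u \<rho> w"
  proof (rule word_matrix_least[OF A ends])
    fix u' :: "'s list" and \<rho>'
    assume \<rho>': "is_path \<Gamma> (length u' + 1) \<rho>'" "hd \<rho>' = hd \<rho>" "last \<rho>' = last \<rho>"
    show "1 * (path_weight ?A u' \<rho>' * word_val (diagonal ?A) u' \<rho>' w) \<le> word_val (diagonal ?A) u \<rho> w"
    proof (cases "path_weight ?A u' \<rho>' = MInf")
      case False
      have "u' = u \<and> \<rho>' = \<rho>"
        using \<rho>' False len dist
        by (intro path_weight_nonzero_unique[where A = ?A])
          (auto simp: is_path_def path_matrix_def split: if_splits)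
      then show ?thesis by (simp add: wt)
    qed simp
  qed
  moreover have "word_val (diagonal ?A) u \<rho> w \<le> word_matrix \<Gamma> ?A w (hd \<rho>) (last \<rho>)"
    using path_weight_word_val_le[of ?A, OF A len sub] by (simp add: wt)
  moreover have "word_val (diagonal ?A) u \<rho> w = word_val a u \<rho> w"
    by (rule word_val_cong[OF _ len]) (simp add: path_matrix_def)
  ultimately show ?thesis by simp
qed

theorem theorem5p2:
  fixes \<Gamma> :: "'g::order set" and n :: nat and w v :: "'s::finite list"
  assumes "max_chain_length \<Gamma> n"
    and "w \<in> free_semigroup" and "v \<in> free_semigroup"
  shows "satisfies_identity (chain_matrices \<Gamma>) (matrix_mult \<Gamma>) w v \<longleftrightarrow>
    (\<forall>u :: 's list. int (length u) \<le> int n - 1 \<longrightarrow>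
      (\<forall>\<rho>. is_path \<Gamma> (length u + 1) \<rho> \<longrightarrow>
        trop_equivalent (word_poly u \<rho> w) (word_poly u \<rho> v)))"
proof -
  have "w \<noteq> []" "v \<noteq> []" using assms(2,3) by (auto simp: free_semigroup_def)
  note identity_iff = satisfies_identity_iff_word_matrix[OF this, of \<Gamma>]
  have equiv_iff: "trop_equivalent (word_poly u \<rho> w) (word_poly u \<rho> v) \<longleftrightarrow>
      (\<forall>a. word_val a u \<rho> w = word_val a u \<rho> v)" if "is_path \<Gamma> (length u + 1) \<rho>" for u \<rho>
    using that by (simp add: trop_equivalent_def trop_eval_word_poly_eq_word_val is_path_def)
  \<comment> \<open>The chain bound enters here: a path with |u| + 1 vertices exists only if |u| + 1
    \<le> n, so the condition on u covers all paths in \<Gamma>. Over the integers n - 1 stays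
    negative for n = 0.\<close>
  have len: "int (length u) \<le> int n - 1" if "is_path \<Gamma> (length u + 1) \<rho>" for u :: "'s list" and \<rho>
    using assms(1) that unfolding max_chain_length_def by (smt (verit) of_nat_1 of_nat_add of_nat_mono)
  show ?thesis
    unfolding identity_iff
  proof (intro iffI allI impI)
    fix u :: "'s list" and \<rho>
    assume eq: "\<forall>A. (\<forall>s. A s \<in> chain_matrices \<Gamma>) \<longrightarrow> word_matrix \<Gamma> A w = word_matrix \<Gamma> A v"
      and \<rho>: "is_path \<Gamma> (length u + 1) \<rho>"
    \<comment> \<open>Every value of either polynomial is the entry at (\<open>hd \<rho>\<close>,
      \<open>last \<rho>\<close>) of such a word matrix, so equal matrices give equal
      values.\<close>
    have "word_matrix \<Gamma> (path_matrix a u \<rho>) w = word_matrix \<Gamma> (path_matrix a u \<rho>) v" for a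
      by (rule eq[rule_format]) (rule path_matrix_closed[OF \<rho>])
    then show "trop_equivalent (word_poly u \<rho> w) (word_poly u \<rho> v)"
      unfolding equiv_iff[OF \<rho>] word_matrix_path_matrix[OF \<rho>, symmetric] by simp
  next
    fix A :: "'s \<Rightarrow> 'g trop_matrix"
    assume eq: "\<forall>u :: 's list. int (length u) \<le> int n - 1 \<longrightarrow>
        (\<forall>\<rho>. is_path \<Gamma> (length u + 1) \<rho> \<longrightarrow>
          trop_equivalent (word_poly u \<rho> w) (word_poly u \<rho> v))"
      and A: "\<forall>s. A s \<in> chain_matrices \<Gamma>"
    have val: "word_val a u \<rho> w = word_val a u \<rho> v" if "is_path \<Gamma> (length u + 1) \<rho>"
      for a and u :: "'s list" and \<rho>
      using eq that len[OF that] equiv_iff[OF that] by blast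
    show "word_matrix \<Gamma> A w = word_matrix \<Gamma> A v"
    proof (intro ext antisym)
      fix i j
      show "word_matrix \<Gamma> A w i j \<le> word_matrix \<Gamma> A v i j"
        by (rule word_matrix_le) (use A val in auto)
      show "word_matrix \<Gamma> A v i j \<le> word_matrix \<Gamma> A w i j"
        by (rule word_matrix_le) (use A val in auto)
    qed
  qed
qed

end
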